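(* For every integer $n\geq 16$, $\mathrm{ex}_{\mathcal{P}}(n,S_{2,2})=2n-4$.
   Context: All graphs are finite and simple. For a graph $F$, the planar Turán number $\mathrm{ex}_{\mathcal{P}}(n,F)$ is the maximum number of edges in an $n$-vertex planar graph that contains no subgraph isomorphic to $F$. For positive integers $m,k$, the double star $S_{m,k}$ is the tree obtained from an edge $xy$ (the backbone) by joining $x$ to $m$ new vertices and $y$ to $k$ further new vertices, all these $m+k$ vertices distinct; thus $S_{m,k}$ has $m+k+2$ vertices. *)

theory Defs
  imports "HOL-Analysis.Analysis"
begin

definition simple_graph :: "'a set \<Rightarrow> 'a set set \<Rightarrow> bool" where
  "simple_graph V E \<longleftrightarrow> finite V \<and>
     (\<forall>e\<in>E. \<exists>u v. u \<in> V \<and> v \<in> V \<and> u \<noteq> v \<and> e = {u, v})"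

definition planar_graph :: "'a set \<Rightarrow> 'a set set \<Rightarrow> bool" where
  "planar_graph V E \<longleftrightarrow> simple_graph V E \<and>
     (\<exists>(f :: 'a \<Rightarrow> real^2) (\<gamma> :: 'a set \<Rightarrow> real \<Rightarrow> real^2).
        inj_on f V \<and>
        (\<forall>e\<in>E. arc (\<gamma> e) \<and> {pathstart (\<gamma> e), pathfinish (\<gamma> e)} = f ` e \<and>
                 path_image (\<gamma> e) \<inter> f ` V = f ` e) \<and>
        (\<forall>e\<in>E. \<forall>e'\<in>E. e \<noteq> e' \<longrightarrow>
                 path_image (\<gamma> e) \<inter> path_image (\<gamma> e') \<subseteq> f ` (e \<inter> e')))"

definition contains_subgraph :: "'a set \<Rightarrow> 'a set set \<Rightarrow> 'b set \<Rightarrow> 'b set set \<Rightarrow> bool" where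
  "contains_subgraph V E VF EF \<longleftrightarrow>
     (\<exists>\<phi>. inj_on \<phi> VF \<and> \<phi> ` VF \<subseteq> V \<and> (\<forall>e\<in>EF. \<phi> ` e \<in> E))"

definition double_star :: "nat \<Rightarrow> nat \<Rightarrow> nat set \<times> nat set set" where
  "double_star m k = ({0..m+k+1},
     {{0, 1}} \<union> {{0, i} | i. 2 \<le> i \<and> i \<le> m + 1} \<union> {{1, i} | i. m + 2 \<le> i \<and> i \<le> m + k + 1})"

definition planar_turan :: "nat \<Rightarrow> 'b set \<times> 'b set set \<Rightarrow> nat" where
  "planar_turan n F = Max {card E | E. \<exists>V :: nat set. card V = n \<and> planar_graph V E \<and>
                              \<not> contains_subgraph V E (fst F) (snd F)}"

end

theory Submission
  imports Defs
begin

text \<open>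
  The graph \<open>K\<^bsub>2,n-2\<^esub>\<close> attains the bound. For the upper bound, planarity enters only through the
  non-planarity of \<open>K\<^sub>5\<close>. Call a vertex big if its degree is at least 3. Two adjacent big vertices have
  at most 3 further neighbours in total, otherwise they would be the backbone of an \<open>S\<^bsub>2,2\<^esub>\<close>;
  hence big vertices with a big neighbour have degree 3 or 4, and if \<open>x\<close> is one of degree 4 then all
  its big neighbours have their neighbourhoods inside the closed neighbourhood of \<open>x\<close>. If moreover
  all neighbours of \<open>x\<close> are big, two of them are non-adjacent, as there is no \<open>K\<^sub>5\<close>, and so have
  degree 3. The bound follows by combining two ways of counting the edges: splitting each edge
  evenly between its ends, and charging the edges between big and small vertices entirely to the
  small end.

  That \<open>K\<^sub>5\<close> is not planar follows from the theta-curve theorem: if two vertices lie inside the triangle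
  formed by the other three, the edges from the first of them cut the inside into three regions,
  each with only two of the triangle's vertices on its boundary, and the second vertex lies in one
  of them. Two vertices outside the triangle are brought inside by an inversion.
\<close>

section \<open>Non-planarity of the complete graph on five vertices\<close>

text \<open>The parametrisation is hidden because only images matter below, and an edge of a graph
  has no preferred direction.\<close>

definition arc_joins :: "'a::topological_space set \<Rightarrow> 'a \<Rightarrow> 'a \<Rightarrow> bool" where
  "arc_joins A a b \<longleftrightarrow> (\<exists>g. arc g \<and> pathstart g = a \<and> pathfinish g = b \<and> path_image g = A)"

lemma arc_joins_sym: "arc_joins A a b \<Longrightarrow> arc_joins A b a"
  unfolding arc_joins_def
  by (metis arc_reversepath path_image_reversepath pathfinish_reversepath pathstart_reversepath)

lemma arc_joins_ends: "arc_joins A a b \<Longrightarrow> a \<in> A \<and> b \<in> A"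
  unfolding arc_joins_def by (metis pathfinish_in_path_image pathstart_in_path_image)

lemma arc_joins_Un:
  assumes "arc_joins A a b" "arc_joins B b c" "A \<inter> B = {b}"
  shows "arc_joins (A \<union> B) a c"
proof -
  obtain g h where g: "arc g" "pathstart g = a" "pathfinish g = b" "path_image g = A"
    and h: "arc h" "pathstart h = b" "pathfinish h = c" "path_image h = B"
    using assms unfolding arc_joins_def by auto
  have "arc (g +++ h)"
    using g h assms(3) by (intro arc_join) auto
  moreover have "pathstart (g +++ h) = a" "pathfinish (g +++ h) = c" "path_image (g +++ h) = A \<union> B"
    using g h by (auto simp: path_image_join)
  ultimately show ?thesis unfolding arc_joins_def by blast
qed

lemma arc_joins_image:
  fixes h :: "'a::t2_space \<Rightarrow> 'b::t2_space"
  assumes "arc_joins A a b" "continuous_on A h" "inj_on h A"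
  shows "arc_joins (h ` A) (h a) (h b)"
proof -
  obtain g where g: "arc g" "pathstart g = a" "pathfinish g = b" "path_image g = A"
    using assms unfolding arc_joins_def by auto
  have "path (h \<circ> g)"
    using g assms by (intro path_continuous_image) (auto simp: arc_imp_path)
  moreover have "inj_on (h \<circ> g) {0..1}"
    using g assms by (intro comp_inj_on) (auto simp: arc_def path_image_def)
  ultimately have "arc (h \<circ> g)" by (auto simp: arc_def)
  then show ?thesis unfolding arc_joins_def
    using g by (metis path_image_compose pathfinish_compose pathstart_compose)
qed

lemma arc_joins_connected:
  assumes "arc_joins A a b"
  shows "connected A"
  using assms connected_arc_image unfolding arc_joins_def by blast

lemma arc_joins_open_nonempty:
  fixes A :: "'a::t2_space set"
  assumes "arc_joins A a b"
  shows "A - {a,b} \<noteq> {}"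
  using assms simple_path_endless arc_imp_simple_path unfolding arc_joins_def 
  by (metis nonempty_simple_path_endless)

lemma arc_joins_connected_minus:
  fixes A :: "'a::t2_space set"
  assumes "arc_joins A a b"
  shows "connected (A - {a})"
proof -
  obtain g where g: "arc g" "pathstart g = a" "pathfinish g = b" "path_image g = A"
    using assms unfolding arc_joins_def by auto
  have "A - {a} = g ` {0<..1}"
    using g unfolding path_image_def pathstart_def arc_def inj_on_def
    apply (auto simp: image_iff Bex_def)
     apply (metis less_eq_real_def)
    by fastforce
  moreover have "continuous_on {0<..1} g"
    using g by (meson arc_def path_def continuous_on_subset greaterThanAtMost_subseteq_atLeastAtMost_iff order_refl)
  ultimately show ?thesis by (simp add: connected_continuous_image)
qed

lemma arc_joins_neq: "arc_joins A a b \<Longrightarrow> a \<noteq> b"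
  unfolding arc_joins_def by (metis arc_distinct_ends)

text \<open>This is the theta-curve theorem \<open>split_inside_simple_closed_curve\<close> for
  point sets. It serves to place a point off \<open>C\<close> in one of two smaller regions, each of
  whose boundaries omits the open arc \<open>A\<close> or \<open>B\<close>.\<close>

lemma theta_inside:
  fixes A B C :: "complex set"
  assumes "arc_joins A a b" "arc_joins B a b" "arc_joins C a b"
    "A \<inter> B = {a,b}" "A \<inter> C = {a,b}" "B \<inter> C = {a,b}" "C \<inter> inside (A \<union> B) \<noteq> {}"
  shows "inside (A \<union> C) \<union> inside (B \<union> C) \<union> (C - {a,b}) = inside (A \<union> B)"
proof -
  obtain f g h where "arc f" "pathstart f = a" "pathfinish f = b" "path_image f = A"
    "arc g" "pathstart g = a" "pathfinish g = b" "path_image g = B"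
    "arc h" "pathstart h = a" "pathfinish h = b" "path_image h = C"
    using assms unfolding arc_joins_def by auto
  then show ?thesis
    using split_inside_simple_closed_curve[of f a b g h] assms arc_joins_neq[OF assms(1)]
    by (auto simp: arc_imp_simple_path)
qed

text \<open>The inside is a union of components of the complement of \<open>J\<close>, and
  \<open>P\<close> stays within one component. All edges are located relative to closed curves in
  this way.\<close>

lemma connected_meets_inside:
  assumes "connected P" "P \<inter> J = {}" "x \<in> P" "x \<in> inside J"
  shows "P \<subseteq> inside J"
proof
  fix y assume "y \<in> P"
  then have "connected_component (- J) x y"
    using assms by (auto simp: connected_component_def)
  then show "y \<in> inside J"
    using assms(4) by (metis inside_same_component)
qed

section \<open>Drawings of complete graphs\<close>

text \<open>Vertices are identified with points, and \<open>A e\<close> is the image of the edge \<open>e\<close>.\<close>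
definition complete_drawing :: "'a::topological_space set \<Rightarrow> ('a set \<Rightarrow> 'a set) \<Rightarrow> bool" where
  "complete_drawing V A \<longleftrightarrow>
    (\<forall>x\<in>V. \<forall>y\<in>V. x \<noteq> y \<longrightarrow> arc_joins (A {x,y}) x y \<and> A {x,y} \<inter> V = {x,y}) \<and>
    (\<forall>x\<in>V. \<forall>y\<in>V. \<forall>u\<in>V. \<forall>w\<in>V. x \<noteq> y \<longrightarrow> u \<noteq> w \<longrightarrow> {x,y} \<noteq> {u,w} \<longrightarrow>
       A {x,y} \<inter> A {u,w} \<subseteq> {x,y} \<inter> {u,w})"

lemma complete_drawing_arc:
  "complete_drawing V A \<Longrightarrow> x \<in> V \<Longrightarrow> y \<in> V \<Longrightarrow> x \<noteq> y \<Longrightarrow> arc_joins (A {x,y}) x y"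
  by (auto simp: complete_drawing_def)

lemma complete_drawing_vertices:
  "complete_drawing V A \<Longrightarrow> x \<in> V \<Longrightarrow> y \<in> V \<Longrightarrow> x \<noteq> y \<Longrightarrow> A {x,y} \<inter> V = {x,y}"
  by (auto simp: complete_drawing_def)

lemma complete_drawing_Int:
  assumes "complete_drawing V A" "x \<in> V" "y \<in> V" "u \<in> V" "w \<in> V" "x \<noteq> y" "u \<noteq> w" "{x,y} \<noteq> {u,w}"
  shows "A {x,y} \<inter> A {u,w} = {x,y} \<inter> {u,w}"
proof
  show "A {x,y} \<inter> A {u,w} \<subseteq> {x,y} \<inter> {u,w}"
    using assms unfolding complete_drawing_def by blast
  show "{x,y} \<inter> {u,w} \<subseteq> A {x,y} \<inter> A {u,w}"
    using complete_drawing_vertices[OF assms(1,2,3,6)] complete_drawing_vertices[OF assms(1,4,5,7)]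
    by blast
qed

text \<open>Two theta curves, with chords \<open>adb\<close> and \<open>cd\<close>, cut the inside
  of the triangle into \<open>?I1\<close>, \<open>?I2\<close> and \<open>?I3\<close>, whose
  boundaries run through \<open>a,b,d\<close>, through \<open>a,c,d\<close> and through
  \<open>b,c,d\<close>. The edge from \<open>e\<close> to the missing corner avoids the boundary of
  the region of \<open>e\<close>, so this corner would lie inside the triangle.\<close>

lemma K5_not_inside_triangle:
  fixes V :: "complex set"
  assumes D: "complete_drawing V A" and V: "V = {a,b,c,d,e}" and dist: "distinct [a,b,c,d,e]"
    and inside: "d \<in> inside (A {a,b} \<union> A {b,c} \<union> A {a,c})" "e \<in> inside (A {a,b} \<union> A {b,c} \<union> A {a,c})"
  shows False
proof -
  note arc = complete_drawing_arc[OF D] and verts = complete_drawing_vertices[OF D]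
    and Int = complete_drawing_Int[OF D]
  have in_V: "a \<in> V" "b \<in> V" "c \<in> V" "d \<in> V" "e \<in> V" using V by auto
  have neq: "a \<noteq> b" "a \<noteq> c" "a \<noteq> d" "a \<noteq> e" "b \<noteq> c" "b \<noteq> d" "b \<noteq> e" "c \<noteq> d" "c \<noteq> e" "d \<noteq> e"
    using dist by auto
  note neq' = neq neq[symmetric]
  let ?J = "A {a,b} \<union> A {b,c} \<union> A {a,c}"
  have ab: "arc_joins (A {a,b}) a b" using arc in_V neq' by simp
  have acb: "arc_joins (A {a,c} \<union> A {b,c}) a b"
  proof (rule arc_joins_Un)
    show "arc_joins (A {a,c}) a c" using arc in_V neq' by simp
    show "arc_joins (A {b,c}) c b" using arc_joins_sym[OF arc] in_V neq' by simp
    show "A {a,c} \<inter> A {b,c} = {c}"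
      using Int[of a c b c] in_V neq' by (auto simp: doubleton_eq_iff)
  qed
  have adb: "arc_joins (A {a,d} \<union> A {b,d}) a b"
  proof (rule arc_joins_Un)
    show "arc_joins (A {a,d}) a d" using arc in_V neq' by simp
    show "arc_joins (A {b,d}) d b" using arc_joins_sym[OF arc] in_V neq' by simp
    show "A {a,d} \<inter> A {b,d} = {d}"
      using Int[of a d b d] in_V neq' by (auto simp: doubleton_eq_iff)
  qed
  \<comment> \<open>These equations are rewrite rules for use after distributing over unions, so
    some pairs appear in both orders. The pairs with \<open>e\<close> match each region's boundary
    with the edge from \<open>e\<close> to the corner it misses.\<close>
  have I: "A {a,b} \<inter> A {b,c} = {b}" "A {a,b} \<inter> A {a,c} = {a}" "A {a,b} \<inter> A {a,d} = {a}"
    "A {a,b} \<inter> A {b,d} = {b}" "A {a,c} \<inter> A {a,d} = {a}" "A {a,c} \<inter> A {b,d} = {}"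
    "A {b,c} \<inter> A {a,d} = {}" "A {b,c} \<inter> A {b,d} = {b}" "A {c,d} \<inter> A {a,d} = {d}"
    "A {c,d} \<inter> A {b,d} = {d}" "A {c,d} \<inter> A {a,b} = {}" "A {c,d} \<inter> A {a,c} = {c}" "A {c,d} \<inter> A {b,c} = {c}"
    "A {a,c} \<inter> A {b,c} = {c}" "A {a,d} \<inter> A {b,d} = {d}"
    "A {a,d} \<inter> A {b,c} = {}" "A {a,c} \<inter> A {c,d} = {c}" "A {a,d} \<inter> A {c,d} = {d}"
    "A {b,c} \<inter> A {c,d} = {c}" "A {b,d} \<inter> A {c,d} = {d}"
    "A {a,b} \<inter> A {c,e} = {}" "A {a,d} \<inter> A {c,e} = {}" "A {b,d} \<inter> A {c,e} = {}"
    "A {a,c} \<inter> A {b,e} = {}" "A {a,d} \<inter> A {b,e} = {}" "A {c,d} \<inter> A {b,e} = {}"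
    "A {b,c} \<inter> A {a,e} = {}" "A {b,d} \<inter> A {a,e} = {}" "A {c,d} \<inter> A {a,e} = {}"
    by (subst Int; use in_V neq' in \<open>auto simp: doubleton_eq_iff\<close>)+
  have J: "A {a,b} \<union> (A {a,c} \<union> A {b,c}) = ?J" by blast
  have dJ: "d \<in> A {a,d} \<union> A {b,d}" using verts[of a d] in_V neq' by auto
  have th1: "inside (A {a,b} \<union> (A {a,d} \<union> A {b,d})) \<union> inside ((A {a,c} \<union> A {b,c}) \<union> (A {a,d} \<union> A {b,d})) \<union>
      ((A {a,d} \<union> A {b,d}) - {a,b}) = inside ?J"
  proof -
    have "inside (A {a,b} \<union> (A {a,d} \<union> A {b,d})) \<union> inside ((A {a,c} \<union> A {b,c}) \<union> (A {a,d} \<union> A {b,d})) \<union>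
      ((A {a,d} \<union> A {b,d}) - {a,b}) = inside (A {a,b} \<union> (A {a,c} \<union> A {b,c}))"
    proof (rule theta_inside[OF ab acb adb])
      show "(A {a,d} \<union> A {b,d}) \<inter> inside (A {a,b} \<union> (A {a,c} \<union> A {b,c})) \<noteq> {}"
        unfolding J using dJ inside(1) by blast
    qed (simp_all only: Int_Un_distrib Int_Un_distrib2 I, auto)
    then show ?thesis unfolding J .
  qed
  let ?I1 = "inside (A {a,b} \<union> (A {a,d} \<union> A {b,d}))"
  let ?Q = "(A {a,c} \<union> A {b,c}) \<union> (A {a,d} \<union> A {b,d})"
  have not_inside: "a \<notin> inside ?J" "b \<notin> inside ?J" "c \<notin> inside ?J"
  proof -
    have "a \<in> ?J" "b \<in> ?J" "c \<in> ?J"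
      using verts[of a b] verts[of b c] in_V neq' by blast+
    then show "a \<notin> inside ?J" "b \<notin> inside ?J" "c \<notin> inside ?J"
      using inside_no_overlap[of ?J] by blast+
  qed
  have c1: "c \<notin> ?I1" using th1 not_inside by blast
  have cd: "arc_joins (A {c,d}) c d" using arc in_V neq' by simp
  \<comment> \<open>The edge \<open>cd\<close> meets the triangle only in \<open>c\<close>, and its
    other end \<open>d\<close> is inside.\<close>
  have "A {c,d} - {c} \<subseteq> inside ?J"
  proof (rule connected_meets_inside)
    show "connected (A {c,d} - {c})" using arc_joins_connected_minus[OF cd] .
    have "A {c,d} \<inter> ?J = {c}" by (simp only: Int_Un_distrib I Un_empty_left Un_absorb)
    then show "(A {c,d} - {c}) \<inter> ?J = {}" by blast
    show "d \<in> A {c,d} - {c}" using arc_joins_ends[OF cd] neq by blast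
    show "d \<in> inside ?J" by fact
  qed
  \<comment> \<open>Away from \<open>d\<close> this edge misses the boundary of \<open>?I1\<close>;
    a single point of it in \<open>?I1\<close> would drag \<open>c\<close> along.\<close>
  moreover have "(A {c,d} - {d}) \<inter> ?I1 = {}"
  proof (rule ccontr)
    assume "\<not> ?thesis"
    then obtain x where x: "x \<in> A {c,d} - {d}" "x \<in> ?I1" by blast
    have "A {c,d} - {d} \<subseteq> ?I1"
    proof (rule connected_meets_inside)
      show "connected (A {c,d} - {d})" using arc_joins_connected_minus[OF arc_joins_sym[OF cd]] .
      have "A {c,d} \<inter> (A {a,b} \<union> (A {a,d} \<union> A {b,d})) = {d}"
        by (simp only: Int_Un_distrib I Un_empty_left Un_absorb)
      then show "(A {c,d} - {d}) \<inter> (A {a,b} \<union> (A {a,d} \<union> A {b,d})) = {}" by blast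
    qed (use x in auto)
    moreover have "c \<in> A {c,d} - {d}" using arc_joins_ends[OF cd] neq by blast
    ultimately show False using c1 by blast
  qed
  \<comment> \<open>An inner point of \<open>cd\<close> lies inside the triangle, outside
    \<open>?I1\<close> and off the chord \<open>adb\<close>, hence inside \<open>?Q\<close>. It
    witnesses that \<open>cd\<close> is a genuine chord for the second theta curve.\<close>
  moreover obtain m where m: "m \<in> A {c,d}" "m \<noteq> c" "m \<noteq> d"
    using arc_joins_open_nonempty[OF cd] by blast
  moreover have "m \<notin> A {a,d} \<union> A {b,d}"
    using m I(9,10) by blast
  ultimately have mQ: "m \<in> inside ?Q"
    using th1 by blast
  \<comment> \<open>The boundary of \<open>?Q\<close> is regrouped into two arcs from
    \<open>c\<close> to \<open>d\<close>, so that \<open>cd\<close> can serve as a chord.\<close>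
  have cad: "arc_joins (A {a,c} \<union> A {a,d}) c d"
  proof (rule arc_joins_Un)
    show "arc_joins (A {a,c}) c a" using arc_joins_sym[OF arc] in_V neq' by simp
    show "arc_joins (A {a,d}) a d" using arc in_V neq' by simp
  qed (simp only: I)
  have cbd: "arc_joins (A {b,c} \<union> A {b,d}) c d"
  proof (rule arc_joins_Un)
    show "arc_joins (A {b,c}) c b" using arc_joins_sym[OF arc] in_V neq' by simp
    show "arc_joins (A {b,d}) b d" using arc in_V neq' by simp
  qed (simp only: I)
  have Q: "(A {a,c} \<union> A {a,d}) \<union> (A {b,c} \<union> A {b,d}) = ?Q" by blast
  let ?I2 = "inside ((A {a,c} \<union> A {a,d}) \<union> A {c,d})"
  let ?I3 = "inside ((A {b,c} \<union> A {b,d}) \<union> A {c,d})"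
  have th2: "?I2 \<union> ?I3 \<union> (A {c,d} - {c,d}) = inside ?Q"
  proof -
    have "inside (A {a, c} \<union> A {a, d} \<union> A {c, d}) \<union> inside (A {b, c} \<union> A {b, d} \<union> A {c, d}) \<union>
       (A {c, d} - {c, d}) = inside ((A {a,c} \<union> A {a,d}) \<union> (A {b,c} \<union> A {b,d}))"
    proof (rule theta_inside[OF cad cbd cd])
      show "A {c, d} \<inter> inside (A {a, c} \<union> A {a, d} \<union> (A {b, c} \<union> A {b, d})) \<noteq> {}"
        using mQ m unfolding Q by blast
    qed (simp_all only: Int_Un_distrib Int_Un_distrib2 I, auto)
    then show ?thesis unfolding Q .
  qed
  have e_notin: "e \<notin> A {x,y}" if "x \<in> V" "y \<in> V" "x \<noteq> y" "x \<noteq> e" "y \<noteq> e" for x y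
    using verts[of x y] that in_V by auto
  \<comment> \<open>Here \<open>K\<close> bounds the region of \<open>e\<close> and \<open>x\<close>
    is the corner missing from it: the edge \<open>xe\<close> never crosses \<open>K\<close>, so it
    pulls \<open>x\<close> inside.\<close>
  have conf: False if "e \<in> inside K" "K \<inter> A {x,e} = {}" "x \<in> V" "x \<noteq> e" "inside K \<subseteq> inside ?J" "x \<notin> inside ?J" for K x
  proof -
    have xe: "arc_joins (A {x,e}) x e" using arc that in_V by blast
    have "A {x,e} \<subseteq> inside K"
      by (rule connected_meets_inside[of _ _ e])
         (use that arc_joins_connected[OF xe] arc_joins_ends[OF xe] in auto)
    then show False using arc_joins_ends[OF xe] that by blast
  qed
  have "e \<notin> A {a,d}" "e \<notin> A {b,d}" "e \<notin> A {c,d}" using e_notin in_V neq' by simp_all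
  then consider "e \<in> ?I1" | "e \<in> ?I2" | "e \<in> ?I3"
    using th1 th2 inside(2) by blast
  then show False
  proof cases
    case 1
    show False
    proof (rule conf[OF 1])
      show "(A {a,b} \<union> (A {a,d} \<union> A {b,d})) \<inter> A {c,e} = {}"
        by (simp only: Int_Un_distrib2 I Un_empty_left)
    qed (use in_V neq' not_inside th1 in auto)
  next
    case 2
    show False
    proof (rule conf[OF 2])
      show "(A {a,c} \<union> A {a,d} \<union> A {c,d}) \<inter> A {b,e} = {}"
        by (simp only: Int_Un_distrib2 I Un_empty_left)
    qed (use in_V neq' not_inside th1 th2 in auto)
  next
    case 3
    show False
    proof (rule conf[OF 3])
      show "(A {b,c} \<union> A {b,d} \<union> A {c,d}) \<inter> A {a,e} = {}"
        by (simp only: Int_Un_distrib2 I Un_empty_left)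
    qed (use in_V neq' not_inside th1 th2 in auto)
  qed
qed

section \<open>Turning a closed curve inside out\<close>

lemma arc_joins_closed_curve:
  assumes "arc_joins A a b" "arc_joins B a b" "A \<inter> B = {a,b}"
  obtains c where "simple_path c" "pathfinish c = pathstart c" "path_image c = A \<union> B"
proof -
  obtain f where f: "arc f" "pathstart f = a" "pathfinish f = b" "path_image f = A"
    using assms unfolding arc_joins_def by auto
  obtain g where g: "arc g" "pathstart g = b" "pathfinish g = a" "path_image g = B"
    using arc_joins_sym[OF assms(2)] unfolding arc_joins_def by auto
  show thesis
  proof (rule that)
    show "simple_path (f +++ g)" using f g assms(3) by (intro simple_path_join_loop) auto
  qed (use f g in \<open>auto simp: path_image_join\<close>)
qed

lemma inversion_outside_to_inside:
  fixes J :: "complex set"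
  assumes c: "simple_path c" "pathfinish c = pathstart c" "path_image c = J" and z: "z \<in> inside J"
  shows "(\<lambda>w. inverse (w - z)) ` outside J \<subseteq> inside ((\<lambda>w. inverse (w - z)) ` J)"
proof -
  define h where "h = (\<lambda>w. inverse (w - z))"
  \<comment> \<open>Injectivity extends to \<open>z\<close> itself: \<open>inverse 0 = 0\<close>
    gives \<open>z\<close> the only value that no other point takes.\<close>
  have inj: "inj h" by (auto simp: h_def inj_on_def)
  have zJ: "z \<notin> J" and z_out: "z \<notin> outside J" using z by (auto simp: inside_def outside_def)
  have cont: "continuous_on X h" if "z \<notin> X" for X
    unfolding h_def using that by (auto intro!: continuous_intros)
  have Jord: "open (inside J)" "connected (inside J)" "connected (outside J)" "\<not> bounded (outside J)"
    using Jordan_inside_outside[OF c(1,2)] c(3) by auto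
  have "simple_path (h \<circ> c)"
    using c zJ inj by (intro simple_path_continuous_image cont) (auto intro: inj_on_subset)
  moreover have "pathfinish (h \<circ> c) = pathstart (h \<circ> c)"
    using c by (simp add: pathfinish_compose pathstart_compose)
  moreover have "path_image (h \<circ> c) = h ` J"
    using c by (simp add: path_image_compose)
  ultimately have ne: "inside (h ` J) \<noteq> {}"
    using Jordan_inside_outside[of "h \<circ> c"] by simp
  define I where "I = h ` (inside J - {z})"
  \<comment> \<open>The added 0 is the image of the point at infinity.\<close>
  define U where "U = insert 0 (h ` outside J)"
  have "connected I" unfolding I_def
    using Jord by (intro connected_continuous_image cont connected_open_delete) auto
  moreover have I_J: "I \<inter> h ` J = {}"
    using inj inside_no_overlap[of J] unfolding I_def inj_def by blast
  moreover have "\<not> bounded I"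
  proof
    assume "bounded I"
    then obtain B where B: "B > 0" "\<And>x. x \<in> I \<Longrightarrow> norm x \<le> B" by (auto simp: bounded_pos)
    obtain e where e: "e > 0" "ball z e \<subseteq> inside J" using Jord(1) z open_contains_ball by blast
    \<comment> \<open>The point \<open>z + r\<close> stays in the ball around \<open>z\<close>,
      while its image has norm \<open>1 / r \<ge> 2 * B\<close>.\<close>
    define r where "r = min (e/2) (1 / (2*B))"
    have r: "r > 0" "r < e" "r \<le> 1 / (2*B)" using e B by (auto simp: r_def)
    have "z + of_real r \<in> inside J - {z}" using r e by (auto simp: dist_norm)
    then have "norm (h (z + of_real r)) \<le> B" using B by (auto simp: I_def)
    moreover have "norm (h (z + of_real r)) = 1 / r"
      using r(1) by (simp add: h_def norm_inverse inverse_eq_divide norm_divide)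
    ultimately have "1 / r \<le> B" by simp
    moreover have "1 / r \<ge> 2 * B" using r(1,3) B(1) by (simp add: field_simps)
    ultimately show False using B by linarith
  qed
  ultimately have I_out: "I \<subseteq> outside (h ` J)"
  proof -
    have "I \<subseteq> connected_component_set (- h ` J) x" if "x \<in> I" for x
      using that \<open>connected I\<close> I_J by (intro connected_component_maximal) auto
    then show ?thesis
      using \<open>\<not> bounded I\<close> I_J by (auto simp: outside_def) (meson bounded_subset)
  qed
  have cover: "- h ` J \<subseteq> I \<union> U"
  proof
    fix y assume y: "y \<in> - h ` J"
    show "y \<in> I \<union> U"
    proof (cases "y = 0")
      case False
      define w where "w = z + inverse y"
      have w: "h w = y" "w \<noteq> z" using False by (auto simp: h_def w_def)
      then have "w \<notin> J" using y by auto
      then have "w \<in> inside J \<or> w \<in> outside J" using inside_Un_outside[of J] by blast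
      then show ?thesis using w by (auto simp: I_def U_def)
    qed (auto simp: U_def)
  qed
  have "connected U"
  proof (rule connected_intermediate_closure)
    show "connected (h ` outside J)" using Jord z_out by (intro connected_continuous_image cont)
    show "h ` outside J \<subseteq> U" by (auto simp: U_def)
    \<comment> \<open>Points of the unbounded outside far from \<open>z\<close> are mapped close to
      0.\<close>
    have "0 \<in> closure (h ` outside J)"
      unfolding closure_approachable
    proof (intro allI impI)
      fix e :: real assume e: "e > 0"
      obtain w where w: "w \<in> outside J" "norm w > norm z + 1 / e"
        using Jord(4) unfolding bounded_iff by (meson linorder_not_le)
      then have "norm (w - z) > 1 / e" using norm_triangle_ineq2[of w z] by linarith
      then have "norm (h w) < e"
        using e by (simp add: h_def norm_inverse divide_inverse)
          (metis inverse_inverse_eq less_imp_inverse_less positive_imp_inverse_positive)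
      then show "\<exists>y\<in>h ` outside J. dist y 0 < e" using w by auto
    qed
    then show "U \<subseteq> closure (h ` outside J)"
      using closure_subset[of "h ` outside J"] unfolding U_def by blast
  qed
  moreover have "U \<inter> h ` J = {}"
  proof -
    have "0 \<notin> h ` J" using zJ by (auto simp: h_def)
    moreover have "h ` outside J \<inter> h ` J = {}"
      using outside_no_overlap[of J] inj by (metis image_Int image_empty)
    ultimately show ?thesis by (auto simp: U_def)
  qed
  moreover obtain x where "x \<in> inside (h ` J)" using ne by blast
  moreover from this have "x \<in> U"
    using cover I_out inside_no_overlap[of "h ` J"] inside_Int_outside[of "h ` J"] by blast
  ultimately have "U \<subseteq> inside (h ` J)" using connected_meets_inside by blast
  then show ?thesis by (auto simp: U_def h_def)
qed

section \<open>Excluding five vertices\<close>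

text \<open>Serves both the inversion and the passage from \<open>real^2\<close> to the complex
  plane. Edges are indexed by their sets of end points, so an image edge is looked up through
  \<open>inv_into\<close>.\<close>

lemma complete_drawing_image:
  fixes h :: "'a::t2_space \<Rightarrow> 'b::t2_space"
  assumes D: "complete_drawing V A" and cont: "continuous_on X h" and inj: "inj_on h X"
    and V: "V \<subseteq> X" and A: "\<And>x y. x \<in> V \<Longrightarrow> y \<in> V \<Longrightarrow> x \<noteq> y \<Longrightarrow> A {x,y} \<subseteq> X"
  shows "complete_drawing (h ` V) (\<lambda>e. h ` A (inv_into V h ` e))"
proof -
  have injV: "inj_on h V" using inj V inj_on_subset by blast
  have inv: "inv_into V h ` {h x, h y} = {x,y}" if "x \<in> V" "y \<in> V" for x y
    using that injV by simp
  have 1: "arc_joins (h ` A {x,y}) (h x) (h y) \<and> h ` A {x,y} \<inter> h ` V = {h x, h y}"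
    if "x \<in> V" "y \<in> V" "x \<noteq> y" for x y
  proof
    show "arc_joins (h ` A {x,y}) (h x) (h y)"
      using complete_drawing_arc[OF D that] A[OF that] cont inj
      by (meson arc_joins_image continuous_on_subset inj_on_subset)
    have "h ` A {x,y} \<inter> h ` V = h ` (A {x,y} \<inter> V)"
      using inj_on_image_Int[OF inj A[OF that] V] by simp
    then show "h ` A {x,y} \<inter> h ` V = {h x, h y}"
      using complete_drawing_vertices[OF D that] by simp
  qed
  have 2: "h ` A {x,y} \<inter> h ` A {u,w} \<subseteq> {h x, h y} \<inter> {h u, h w}"
    if "x \<in> V" "y \<in> V" "u \<in> V" "w \<in> V" "x \<noteq> y" "u \<noteq> w" "{x,y} \<noteq> {u,w}" for x y u w
  proof -
    have "h ` A {x,y} \<inter> h ` A {u,w} = h ` (A {x,y} \<inter> A {u,w})"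
      using inj_on_image_Int[OF inj] A that by metis
    also have "\<dots> = h ` ({x,y} \<inter> {u,w})" using complete_drawing_Int[OF D that] by simp
    finally show ?thesis by auto
  qed
  show ?thesis
    unfolding complete_drawing_def ball_simps
  proof (intro conjI ballI impI)
    fix x y assume xy: "x \<in> V" "y \<in> V" "h x \<noteq> h y"
    then show "arc_joins (h ` A (inv_into V h ` {h x, h y})) (h x) (h y)"
      "h ` A (inv_into V h ` {h x, h y}) \<inter> h ` V = {h x, h y}"
      using 1[of x y] inv[of x y] by auto
  next
    fix x y u w assume xy: "x \<in> V" "y \<in> V" "u \<in> V" "w \<in> V" "h x \<noteq> h y" "h u \<noteq> h w" "{h x, h y} \<noteq> {h u, h w}"
    then have "{x,y} \<noteq> {u,w}" "x \<noteq> y" "u \<noteq> w" by (auto simp: doubleton_eq_iff)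
    then show "h ` A (inv_into V h ` {h x, h y}) \<inter> h ` A (inv_into V h ` {h u, h w}) \<subseteq> {h x, h y} \<inter> {h u, h w}"
      using 2[of x y u w] inv xy by simp
  qed
qed

text \<open>The edge \<open>ed\<close> avoids the triangle \<open>J\<close> on \<open>a,b,c\<close>,
  so \<open>d\<close> and \<open>e\<close> are both inside it or both not. In the second case no
  edge enters the inside, so inverting at a point \<open>z\<close> there keeps the drawing intact
  and brings \<open>d\<close> and \<open>e\<close> inside the image of \<open>J\<close>.\<close>

lemma no_complete_drawing_5:
  fixes V :: "complex set"
  assumes D: "complete_drawing V A" and "card V = 5"
  shows False
proof -
  note arc = complete_drawing_arc[OF D] and verts = complete_drawing_vertices[OF D]
    and Int = complete_drawing_Int[OF D]
  obtain a b c d e where V: "V = {a,b,c,d,e}" and dist: "distinct [a,b,c,d,e]"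
  proof -
    obtain xs where xs: "set xs = V" "distinct xs"
      using assms(2) by (metis card.infinite finite_distinct_list zero_neq_numeral)
    then have "length xs = 5" using assms(2) distinct_card by metis
    then show thesis using that xs by (auto simp: numeral_eq_Suc length_Suc_conv)
  qed
  have in_V: "a \<in> V" "b \<in> V" "c \<in> V" "d \<in> V" "e \<in> V" using V by auto
  have neq: "a \<noteq> b" "a \<noteq> c" "a \<noteq> d" "a \<noteq> e" "b \<noteq> c" "b \<noteq> d" "b \<noteq> e" "c \<noteq> d" "c \<noteq> e" "d \<noteq> e"
    using dist by auto
  note neq' = neq neq[symmetric]
  define J where "J = A {a,b} \<union> A {b,c} \<union> A {a,c}"
  have ab: "arc_joins (A {a,b}) a b" using arc in_V neq' by simp
  have acb: "arc_joins (A {a,c} \<union> A {b,c}) a b"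
  proof (rule arc_joins_Un)
    show "arc_joins (A {a,c}) a c" using arc in_V neq' by simp
    show "arc_joins (A {b,c}) c b" using arc_joins_sym[OF arc] in_V neq' by simp
    show "A {a,c} \<inter> A {b,c} = {c}"
      using Int[of a c b c] in_V neq' by (auto simp: doubleton_eq_iff)
  qed
  have "A {a,b} \<inter> (A {a,c} \<union> A {b,c}) = {a,b}"
    using Int[of a b a c] Int[of a b b c] in_V neq' by (auto simp: doubleton_eq_iff Int_Un_distrib)
  then obtain \<gamma> where \<gamma>: "simple_path \<gamma>" "pathfinish \<gamma> = pathstart \<gamma>" "path_image \<gamma> = J"
    using arc_joins_closed_curve[OF ab acb] unfolding J_def by (metis Un_assoc Un_commute)
  have V_J: "V \<inter> J = {a,b,c}"
    using verts[of a b] verts[of b c] verts[of a c] in_V neq' unfolding J_def by blast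
  have de_J: "d \<notin> J" "e \<notin> J" using V_J in_V neq' by blast+
  \<comment> \<open>An edge ending at \<open>d\<close> or \<open>e\<close> can share with a triangle
    edge only its other end \<open>x\<close>.\<close>
  have arc_J: "A {x,y} \<inter> J \<subseteq> {x}" if "x \<in> V" "y \<in> V" "x \<noteq> y" "y = d \<or> y = e" for x y
  proof -
    have "A {x,y} \<inter> A {u,w} \<subseteq> {x}" if "{u,w} \<subseteq> {a,b,c}" "u \<noteq> w" for u w
    proof -
      have "y \<notin> {u,w}" using that \<open>y = d \<or> y = e\<close> neq' by auto
      then have "{x,y} \<noteq> {u,w}" "{x,y} \<inter> {u,w} \<subseteq> {x}" by auto
      moreover have "u \<in> V" "w \<in> V" using that in_V by auto
      ultimately show ?thesis using Int[of x y u w] \<open>x \<in> V\<close> \<open>y \<in> V\<close> \<open>x \<noteq> y\<close> that by metis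
    qed
    from this[of a b] this[of b c] this[of a c] show ?thesis using neq unfolding J_def by blast
  qed
  \<comment> \<open>Without \<open>x\<close> the arc misses \<open>J\<close>, so entering the inside
    would put its end \<open>y\<close> there.\<close>
  have side: "A {x,y} \<inter> inside J = {}" if "x \<in> V" "y \<in> V" "x \<noteq> y" "y = d \<or> y = e" "y \<notin> inside J" "x \<notin> inside J" for x y
  proof (rule ccontr)
    assume "\<not> ?thesis"
    then obtain z where z: "z \<in> A {x,y}" "z \<in> inside J" by blast
    have xy: "arc_joins (A {x,y}) x y" using arc that by blast
    have "A {x,y} - {x} \<subseteq> inside J"
    proof (rule connected_meets_inside)
      show "connected (A {x,y} - {x})" by (rule arc_joins_connected_minus[OF xy])
      show "(A {x,y} - {x}) \<inter> J = {}" using arc_J[OF that(1-4)] by blast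
      show "z \<in> A {x,y} - {x}" using z that(6) by blast
    qed (use z in auto)
    then show False using arc_joins_ends[OF xy] that by blast
  qed
  have ed: "arc_joins (A {e,d}) e d" "A {e,d} \<inter> J = {}"
    using arc[of e d] arc_J[of e d] de_J in_V neq' by auto
  have same: "e \<in> inside J" if "d \<in> inside J"
    using connected_meets_inside[OF arc_joins_connected[OF ed(1)] ed(2) _ that] arc_joins_ends[OF ed(1)] by blast
  have same': "d \<in> inside J" if "e \<in> inside J"
    using connected_meets_inside[OF arc_joins_connected[OF ed(1)] ed(2) _ that] arc_joins_ends[OF ed(1)] by blast
  show False
  proof (cases "d \<in> inside J")
    case True
    then show False using K5_not_inside_triangle[OF D V dist] same unfolding J_def by blast
  next
    case False
    then have out: "d \<notin> inside J" "e \<notin> inside J" using same' by auto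
    obtain z where z: "z \<in> inside J" using Jordan_inside_outside[OF \<gamma>(1,2)] \<gamma>(3) by auto
    define h where "h = (\<lambda>w. inverse (w - z))"
    have h_in: "h ` outside J \<subseteq> inside (h ` J)"
      unfolding h_def using inversion_outside_to_inside[OF \<gamma> z] .
    have abc_in: "a \<notin> inside J" "b \<notin> inside J" "c \<notin> inside J"
      using V_J inside_no_overlap[of J] by blast+
    have V_out: "V \<inter> inside J = {}" using V out abc_in by blast
    have inj: "inj h" by (auto simp: h_def inj_on_def)
    \<comment> \<open>Edges at \<open>d\<close> or \<open>e\<close> miss the centre \<open>z\<close>
      by \<open>side\<close>; the other three edges are parts of \<open>J\<close>.\<close>
    have arcs: "A {x,y} \<subseteq> - {z}" if "x \<in> V" "y \<in> V" "x \<noteq> y" for x y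
    proof -
      have "z \<notin> A {x,y}" if "x \<in> V" "y \<in> V" "x \<noteq> y" "y = d \<or> y = e" for x y
        using side[OF that] V_out that z by blast
      moreover from this have "z \<notin> A {x,y}" if "x \<in> V" "y \<in> V" "x \<noteq> y" "x = d \<or> x = e" for x y
        using that by (metis insert_commute)
      moreover have "z \<notin> A {x,y}" if "{x,y} \<subseteq> {a,b,c}" "x \<noteq> y"
      proof -
        have "{x,y} = {a,b} \<or> {x,y} = {b,c} \<or> {x,y} = {a,c}"
          using that by auto
        then have "A {x,y} \<subseteq> J" unfolding J_def by auto
        then show ?thesis using z inside_no_overlap[of J] by blast
      qed
      ultimately show ?thesis using that V by auto
    qed
    define A' where "A' = (\<lambda>e. h ` A (inv_into V h ` e))"
    have D': "complete_drawing (h ` V) A'"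
      unfolding A'_def
    proof (rule complete_drawing_image[OF D, of "- {z}"])
      show "continuous_on (- {z}) h" unfolding h_def by (auto intro!: continuous_intros)
      show "V \<subseteq> - {z}" using V_out z by blast
    qed (use arcs inj inj_on_subset in blast)+
    have A': "A' {h x, h y} = h ` A {x,y}" if "x \<in> V" "y \<in> V" for x y
      using that inj by (simp add: A'_def inj_on_def inv_into_f_f inj_on_subset)
    have hJ: "A' {h a, h b} \<union> A' {h b, h c} \<union> A' {h a, h c} = h ` J"
      using A' in_V by (simp add: J_def image_Un)
    show False
    proof (rule K5_not_inside_triangle[OF D'])
      show "h ` V = {h a, h b, h c, h d, h e}" using V by simp
      show "distinct [h a, h b, h c, h d, h e]" using dist inj by (simp add: inj_eq)
      have "d \<in> outside J" "e \<in> outside J" using out de_J inside_Un_outside[of J] by blast+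
      then show "h d \<in> inside (A' {h a, h b} \<union> A' {h b, h c} \<union> A' {h a, h c})"
        "h e \<in> inside (A' {h a, h b} \<union> A' {h b, h c} \<union> A' {h a, h c})"
        unfolding hJ using h_in by blast+
    qed
  qed
qed

text \<open>If all pairs in \<open>X\<close> were edges, replacing each vertex by its point under
  \<open>f\<close> would yield a \<open>complete_drawing\<close> on five points.\<close>

lemma planar_graph_no_K5:
  assumes planar: "planar_graph V E" and X: "X \<subseteq> V" "card X = 5"
  shows "\<exists>x\<in>X. \<exists>y\<in>X. x \<noteq> y \<and> {x,y} \<notin> E"
proof (rule ccontr)
  assume "\<not> ?thesis"
  then have edges: "{x,y} \<in> E" if "x \<in> X" "y \<in> X" "x \<noteq> y" for x y using that by blast
  obtain f :: "'a \<Rightarrow> real^2" and \<gamma> :: "'a set \<Rightarrow> real \<Rightarrow> real^2" where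
    f: "inj_on f V" and
    arcs: "\<And>e. e \<in> E \<Longrightarrow> arc (\<gamma> e) \<and> {pathstart (\<gamma> e), pathfinish (\<gamma> e)} = f ` e \<and>
             path_image (\<gamma> e) \<inter> f ` V = f ` e" and
    cross: "\<And>e e'. e \<in> E \<Longrightarrow> e' \<in> E \<Longrightarrow> e \<noteq> e' \<Longrightarrow> path_image (\<gamma> e) \<inter> path_image (\<gamma> e') \<subseteq> f ` (e \<inter> e')"
  proof -
    obtain f :: "'a \<Rightarrow> real^2" and \<gamma> :: "'a set \<Rightarrow> real \<Rightarrow> real^2" where fg: "inj_on f V"
      "\<forall>e\<in>E. arc (\<gamma> e) \<and> {pathstart (\<gamma> e), pathfinish (\<gamma> e)} = f ` e \<and> path_image (\<gamma> e) \<inter> f ` V = f ` e"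
      "\<forall>e\<in>E. \<forall>e'\<in>E. e \<noteq> e' \<longrightarrow> path_image (\<gamma> e) \<inter> path_image (\<gamma> e') \<subseteq> f ` (e \<inter> e')"
      using planar unfolding planar_graph_def by (elim conjE exE) (rule that)
    show thesis
      by (rule that[of f \<gamma>]) (use fg in \<open>simp_all only: Ball_def, blast+\<close>)
  qed
  have fX: "inj_on f X" using f X inj_on_subset by blast
  define A where "A = (\<lambda>e. path_image (\<gamma> (inv_into X f ` e)))"
  have A: "A {f x, f y} = path_image (\<gamma> {x,y})" if "x \<in> X" "y \<in> X" for x y
    using that fX by (simp add: A_def)
  have joins: "arc_joins (path_image (\<gamma> {x,y})) (f x) (f y)" if "x \<in> X" "y \<in> X" "x \<noteq> y" for x y
  proof -
    have g: "arc (\<gamma> {x,y})" "{pathstart (\<gamma> {x,y}), pathfinish (\<gamma> {x,y})} = {f x, f y}"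
      using arcs[OF edges[OF that]] by auto
    then have "arc_joins (path_image (\<gamma> {x,y})) (pathstart (\<gamma> {x,y})) (pathfinish (\<gamma> {x,y}))"
      unfolding arc_joins_def by blast
    \<comment> \<open>The path \<open>\<gamma> {x,y}\<close> may run in either direction.\<close>
    then show ?thesis using g(2) arc_joins_sym by (metis doubleton_eq_iff)
  qed
  have "complete_drawing (f ` X) A"
    unfolding complete_drawing_def ball_simps
  proof (intro conjI ballI impI)
    fix x y assume xy: "x \<in> X" "y \<in> X" "f x \<noteq> f y"
    then have "path_image (\<gamma> {x,y}) \<inter> f ` V = {f x, f y}" using arcs[OF edges, of x y] by auto
    moreover have "{f x, f y} \<subseteq> f ` X" "f ` X \<subseteq> f ` V" using xy X by auto
    ultimately have "path_image (\<gamma> {x,y}) \<inter> f ` X = {f x, f y}" by blast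
    then show "A {f x, f y} \<inter> f ` X = {f x, f y}" using A[OF xy(1,2)] by simp
    show "arc_joins (A {f x, f y}) (f x) (f y)" using joins[OF xy(1,2)] A[OF xy(1,2)] xy(3) by force
  next
    fix x y u w
    assume xy: "x \<in> X" "y \<in> X" "u \<in> X" "w \<in> X" "f x \<noteq> f y" "f u \<noteq> f w" "{f x, f y} \<noteq> {f u, f w}"
    have "{x,y} \<noteq> {u,w}" using xy(7) by (auto simp: doubleton_eq_iff)
    then have "path_image (\<gamma> {x,y}) \<inter> path_image (\<gamma> {u,w}) \<subseteq> f ` ({x,y} \<inter> {u,w})"
      using xy by (intro cross edges) auto
    then show "A {f x, f y} \<inter> A {f u, f w} \<subseteq> {f x, f y} \<inter> {f u, f w}"
      using A[OF xy(1,2)] A[OF xy(3,4)] by auto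
  qed
  then have "complete_drawing ((\<lambda>p. Complex (p$1) (p$2)) ` f ` X)
      (\<lambda>e. (\<lambda>p. Complex (p$1) (p$2)) ` A (inv_into (f ` X) (\<lambda>p. Complex (p$1) (p$2)) ` e))"
  proof (rule complete_drawing_image[where X = UNIV])
    show "continuous_on UNIV (\<lambda>p::real^2. Complex (p$1) (p$2))"
      by (simp add: Complex_eq continuous_intros)
  qed (auto simp: inj_on_def vec_eq_iff forall_2)
  moreover have "card ((\<lambda>p. Complex (p$1) (p$2)) ` f ` X) = 5"
    using X(2) fX by (subst card_image) (auto simp: inj_on_def vec_eq_iff forall_2 card_image)
  ultimately show False by (rule no_complete_drawing_5)
qed

section \<open>The upper bound\<close>

lemma contains_double_star_2_2:
  assumes "distinct [x,y,a,b,c,d]" "{x,y,a,b,c,d} \<subseteq> V"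
    "{{x,y},{x,a},{x,b},{y,c},{y,d}} \<subseteq> E"
  shows "contains_subgraph V E (fst (double_star 2 2)) (snd (double_star 2 2))"
proof -
  \<comment> \<open>The list follows the numbering in \<open>double_star\<close>: 0 and 1 form the
    backbone, 2 and 3 hang on 0, 4 and 5 on 1.\<close>
  define \<phi> where "\<phi> i = [x,y,a,b,c,d] ! i" for i :: nat
  have range: "{0..5::nat} = {0,1,2,3,4,5}" by auto
  have nth: "\<phi> 0 = x" "\<phi> 1 = y" "\<phi> (Suc 0) = y" "\<phi> 2 = a" "\<phi> 3 = b" "\<phi> 4 = c" "\<phi> 5 = d"
    by (simp_all add: \<phi>_def)
  have cases: "{{0, i} |i::nat. 2 \<le> i \<and> i \<le> 3} = {{0,2},{0,3}}"
    "{{1, i} |i::nat. 4 \<le> i \<and> i \<le> 5} = {{1,4},{1,5}}"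
    by (auto simp: le_Suc_eq numeral_eq_Suc) 
  have "inj_on \<phi> {0..5}"
    using assms(1) by (auto simp: range nth)
  moreover have "\<phi> ` {0..5} \<subseteq> V"
    using assms(2) by (auto simp: range nth)
  ultimately show ?thesis
    unfolding contains_subgraph_def double_star_def
    using assms(3) cases by (intro exI[of _ \<phi>]) (simp add: nth)
qed

text \<open>A case of Hall's condition: pick two elements of \<open>A\<close> that leave two in
  \<open>B\<close>. If \<open>A - B\<close> has two elements, take those. Otherwise \<open>B\<close>
  has at least 3 elements, and at least 4 if \<open>A - B\<close> is empty, so it suffices to spend
  the element of \<open>A - B\<close> first when there is one.\<close>

lemma disjoint_pairs:
  assumes "finite A" "finite B" "card A \<ge> 2" "card B \<ge> 2" "card (A \<union> B) \<ge> 4"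
  obtains a b c d where "distinct [a,b,c,d]" "a \<in> A" "b \<in> A" "c \<in> B" "d \<in> B"
proof -
  have pair: "\<exists>x y. x \<in> X \<and> y \<in> X \<and> x \<noteq> y" if "card X \<ge> 2" for X :: "'a set"
    using that by (metis card_2_iff insert_subset obtain_subset_with_card_n)
  have "\<exists>a b. a \<in> A \<and> b \<in> A \<and> a \<noteq> b \<and> card (B - {a,b}) \<ge> 2"
  proof (cases "card (A - B) \<ge> 2")
    case True
    then obtain a b where ab: "a \<in> A - B" "b \<in> A - B" "a \<noteq> b" using pair by meson
    then have "B - {a,b} = B" by blast
    then show ?thesis using ab assms(4) by (metis DiffD1)
  next
    case False
    have "card (A \<union> B) = card (A - B) + card B"
      using assms by (metis Un_Diff_cancel2 card_Un_disjoint Diff_disjoint finite_Diff inf_commute)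
    then have B: "card B \<ge> 4 \<or> (A - B \<noteq> {} \<and> card B \<ge> 3)" using False assms(5) by fastforce
    have rem: "card (B - {a}) + 1 \<ge> card B" for a
      using diff_card_le_card_Diff[of "{a}" B] by simp
    have rem2: "card (B - {a,b}) + 2 \<ge> card B" for a b
      using card_Diff_insert[of a B "{b}"] diff_card_le_card_Diff[of "{a,b}" B]
      by (cases "a = b") auto
    show ?thesis
    proof (cases "A - B = {}")
      case True
      obtain a b where "a \<in> A" "b \<in> A" "a \<noteq> b" using pair assms by meson
      moreover from this have "card (B - {a,b}) \<ge> 2" using B rem2[of a b] True by auto
      ultimately show ?thesis by blast
    next
      case False
      then obtain a where a: "a \<in> A" "a \<notin> B" by blast
      obtain b where b: "b \<in> A" "b \<noteq> a" using pair[OF assms(3)] by metis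
      have "B - {a,b} = B - {b}" using a by blast
      then show ?thesis using a b B rem[of b] by (intro exI[of _ a] exI[of _ b]) auto
    qed
  qed
  then obtain a b where ab: "a \<in> A" "b \<in> A" "a \<noteq> b" "card (B - {a,b}) \<ge> 2" by blast
  then obtain c d where "c \<in> B - {a,b}" "d \<in> B - {a,b}" "c \<noteq> d" using pair by meson
  then show thesis using that[of a b c d] ab by auto
qed

section \<open>Degrees and adjacent big vertices\<close>

locale S22_free_graph =
  fixes V :: "'a set" and E :: "'a set set"
  assumes simple: "simple_graph V E"
    and free: "\<not> contains_subgraph V E (fst (double_star 2 2)) (snd (double_star 2 2))"
    and no_K5: "\<And>X. X \<subseteq> V \<Longrightarrow> card X = 5 \<Longrightarrow> \<exists>x\<in>X. \<exists>y\<in>X. x \<noteq> y \<and> {x,y} \<notin> E"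
begin

definition N :: "'a \<Rightarrow> 'a set" where "N v = {u. {v,u} \<in> E}"

abbreviation deg :: "'a \<Rightarrow> nat" where "deg v \<equiv> card (N v)"

definition "big = {v\<in>V. deg v \<ge> 3}"
definition "small = V - big"

lemma finite_V: "finite V" using simple by (auto simp: simple_graph_def)

lemma edge_in_V: "{u,v} \<in> E \<Longrightarrow> u \<in> V \<and> v \<in> V \<and> u \<noteq> v"
  using simple unfolding simple_graph_def by (metis doubleton_eq_iff)

lemma N_sym: "u \<in> N v \<longleftrightarrow> v \<in> N u" by (simp add: N_def insert_commute)

lemma N_sub: "N v \<subseteq> V" using edge_in_V by (auto simp: N_def)

lemma N_irrefl: "v \<notin> N v" using edge_in_V[of v v] by (auto simp: N_def)

lemma finite_N [simp]: "finite (N v)" using N_sub finite_V finite_subset by blast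

text \<open>The handshake lemma, by counting vertex-edge incidences in two ways.\<close>

lemma card_edges: "2 * card E = (\<Sum>v\<in>V. deg v)"
proof -
  have E_sub: "E \<subseteq> Pow V" using simple by (auto simp: simple_graph_def)
  then have fin: "finite E" using finite_V by (meson finite_Pow_iff finite_subset)
  have c2: "card e = 2" if "e \<in> E" for e
    using simple that by (auto simp: simple_graph_def card_2_iff) (metis)
  have "(\<Sum>v\<in>V. deg v) = (\<Sum>v\<in>V. card {e\<in>E. v \<in> e})"
  proof (rule sum.cong[OF refl])
    fix v assume "v \<in> V"
    have "bij_betw (\<lambda>u. {v,u}) (N v) {e\<in>E. v \<in> e}"
      unfolding bij_betw_def
    proof
      show "inj_on (\<lambda>u. {v,u}) (N v)" by (auto simp: inj_on_def doubleton_eq_iff)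
      show "(\<lambda>u. {v,u}) ` N v = {e\<in>E. v \<in> e}"
      proof
        show "{e\<in>E. v \<in> e} \<subseteq> (\<lambda>u. {v,u}) ` N v"
        proof
          fix e assume e: "e \<in> {e\<in>E. v \<in> e}"
          then obtain x y where "e = {x,y}" using simple by (auto simp: simple_graph_def)
          then have "\<exists>u. e = {v,u}" using e by auto
          then show "e \<in> (\<lambda>u. {v,u}) ` N v" using e by (auto simp: N_def)
        qed
      qed (auto simp: N_def)
    qed
    then show "deg v = card {e\<in>E. v \<in> e}" by (rule bij_betw_same_card)
  qed
  also have "\<dots> = (\<Sum>e\<in>E. card {v\<in>V. v \<in> e})"
    using sum_multicount_gen[OF finite_V fin, of "\<lambda>v e. v \<in> e" "\<lambda>e. card {v\<in>V. v \<in> e}"] by simp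
  also have "\<dots> = (\<Sum>e\<in>E. 2)"
  proof (rule sum.cong[OF refl])
    fix e assume "e \<in> E"
    moreover from this have "{v\<in>V. v \<in> e} = e" using E_sub by auto
    ultimately show "card {v\<in>V. v \<in> e} = 2" using c2 by simp
  qed
  finally show ?thesis by simp
qed

text \<open>Bigness leaves each end at least two neighbours besides the other. If the union had four
  elements, \<open>disjoint_pairs\<close> would supply the leaves of a double star with backbone
  \<open>uv\<close>.\<close>

lemma big_adjacent:
  assumes "u \<in> big" "v \<in> big" "v \<in> N u"
  shows "card ((N u - {v}) \<union> (N v - {u})) \<le> 3"
proof (rule ccontr)
  assume "\<not> ?thesis"
  then have c: "card ((N u - {v}) \<union> (N v - {u})) \<ge> 4" by simp
  have uv: "u \<in> N v" "u \<noteq> v" using assms(3) N_sym N_irrefl by auto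
  obtain a b c d where *: "distinct [a,b,c,d]" "a \<in> N u - {v}" "b \<in> N u - {v}" "c \<in> N v - {u}" "d \<in> N v - {u}"
    by (rule disjoint_pairs[OF _ _ _ _ c]) (use assms uv in \<open>auto simp: big_def\<close>)
  have "contains_subgraph V E (fst (double_star 2 2)) (snd (double_star 2 2))"
  proof (rule contains_double_star_2_2[of u v a b c d])
    show "distinct [u, v, a, b, c, d]" using * uv N_irrefl by auto
    show "{u, v, a, b, c, d} \<subseteq> V" using * uv assms N_sub by (auto simp: big_def)
    show "{{u, v}, {u, a}, {u, b}, {v, c}, {v, d}} \<subseteq> E" using * assms(3) by (auto simp: N_def)
  qed
  then show False using free by blast
qed

lemma big_adjacent_deg:
  assumes "u \<in> big" "v \<in> big" "v \<in> N u"
  shows "deg u \<le> 4"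
proof -
  have "card (N u - {v}) \<le> 3"
    using big_adjacent[OF assms] by (meson card_mono finite_N finite_Diff finite_UnI le_trans sup_ge1)
  then show ?thesis using assms(3) by simp
qed

text \<open>The three vertices of \<open>N u - {v}\<close> already exhaust the bound of
  \<open>big_adjacent\<close>.\<close>

lemma big_adjacent_closed:
  assumes "u \<in> big" "v \<in> big" "v \<in> N u" "deg u = 4"
  shows "N v \<subseteq> insert u (N u)"
proof -
  have "N u - {v} = (N u - {v}) \<union> (N v - {u})"
  proof (rule card_seteq)
    show "card ((N u - {v}) \<union> (N v - {u})) \<le> card (N u - {v})"
      using big_adjacent[OF assms(1-3)] assms(3,4) by simp
  qed auto
  then show ?thesis by blast
qed

text \<open>Mixed vertices turn out to have degree 4, with both big and small neighbours.\<close>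
definition "isolated = {v\<in>big. N v \<inter> big = {}}"
definition "cubic = {v\<in>big - isolated. deg v = 3}"
definition "saturated = {v\<in>big. deg v = 4 \<and> N v \<subseteq> big}"
definition "mixed = big - isolated - cubic - saturated"

lemma fin: "finite big" "finite small" "finite isolated" "finite cubic" "finite saturated" "finite mixed"
  using finite_V by (auto simp: big_def small_def isolated_def cubic_def saturated_def mixed_def)

lemma nonisolated_deg:
  assumes "v \<in> big" "v \<notin> isolated"
  shows "deg v = 3 \<or> deg v = 4"
proof -
  obtain u where "u \<in> N v" "u \<in> big" using assms by (auto simp: isolated_def)
  then have "deg v \<le> 4" using big_adjacent_deg assms by blast
  then show ?thesis using assms(1) by (auto simp: big_def)
qed

text \<open>Among the five vertices of the closed neighbourhood of \<open>x\<close> some two are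
  non-adjacent, and neither is \<open>x\<close>. By \<open>big_adjacent_closed\<close> each of them
  has its neighbours among the remaining three vertices, so its degree is 3; it is not isolated,
  because \<open>x\<close> is big.\<close>

lemma saturated_cubic_neighbours:
  assumes x: "x \<in> saturated"
  shows "card (N x \<inter> cubic) \<ge> 2"
proof -
  have xb: "x \<in> big" "deg x = 4" "N x \<subseteq> big" using x by (auto simp: saturated_def)
  have "insert x (N x) \<subseteq> V" "card (insert x (N x)) = 5"
    using xb N_sub N_irrefl by (auto simp: big_def)
  then obtain a b where ab: "a \<in> insert x (N x)" "b \<in> insert x (N x)" "a \<noteq> b" "{a,b} \<notin> E"
    using no_K5 by blast
  have ab_N: "a \<in> N x" "b \<in> N x"
    using ab by (auto simp: N_def insert_commute)
  have key: "p \<in> cubic" if "p \<in> N x" "q \<in> N x" "p \<noteq> q" "{p,q} \<notin> E" for p q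
  proof -
    have p: "p \<in> big" using that xb by auto
    have "N p \<subseteq> insert x (N x) - {p,q}"
      using big_adjacent_closed[OF xb(1) p that(1) xb(2)] N_irrefl[of p] that(4) by (auto simp: N_def)
    moreover have "card (insert x (N x) - {p,q}) = 3"
      using that \<open>card (insert x (N x)) = 5\<close> by (subst card_Diff_subset) auto
    ultimately have "deg p \<le> 3" by (metis card_mono finite_N finite_Diff finite_insert)
    moreover have "x \<in> N p" using that(1) N_sym by blast
    ultimately show ?thesis using p xb(1) by (auto simp: cubic_def isolated_def big_def)
  qed
  have "{a,b} \<subseteq> N x \<inter> cubic"
    using key[of a b] key[of b a] ab ab_N by (auto simp: insert_commute)
  then have "card {a,b} \<le> card (N x \<inter> cubic)" by (intro card_mono) auto
  then show ?thesis using ab by simp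
qed

section \<open>Counting edges\<close>

lemma sum_card_N_swap:
  assumes "finite A" "finite B"
  shows "(\<Sum>x\<in>A. card (N x \<inter> B)) = (\<Sum>y\<in>B. card (N y \<inter> A))"
proof -
  have "(\<Sum>x\<in>A. card {y\<in>B. y \<in> N x}) = (\<Sum>y\<in>B. card {x\<in>A. y \<in> N x})"
    using sum_multicount_gen[OF assms, of "\<lambda>x y. y \<in> N x" "\<lambda>y. card {x\<in>A. y \<in> N x}"] by simp
  moreover have "{y\<in>B. y \<in> N x} = N x \<inter> B" for x by auto
  moreover have "{x\<in>A. y \<in> N x} = N y \<inter> A" for y using N_sym by auto
  ultimately show ?thesis by simp
qed

text \<open>Double counting of the edges between the two classes: at least 2 at each saturated
  vertex, at most 3 at each cubic one.\<close>

lemma saturated_le_cubic: "2 * card saturated \<le> 3 * card cubic"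
proof -
  have "2 * card saturated \<le> (\<Sum>x\<in>saturated. card (N x \<inter> cubic))"
    using sum_mono[of saturated "\<lambda>_. 2" "\<lambda>x. card (N x \<inter> cubic)"] saturated_cubic_neighbours by simp
  also have "\<dots> = (\<Sum>y\<in>cubic. card (N y \<inter> saturated))" using fin by (intro sum_card_N_swap)
  also have "\<dots> \<le> (\<Sum>y\<in>cubic. 3)"
  proof (rule sum_mono)
    fix y assume "y \<in> cubic"
    then have "deg y = 3" by (auto simp: cubic_def)
    then show "card (N y \<inter> saturated) \<le> 3" by (metis card_mono finite_N inf_le1)
  qed
  finally show ?thesis by simp
qed

lemma big_sum:
  fixes f :: "'a \<Rightarrow> nat"
  shows "(\<Sum>v\<in>big. f v) = sum f isolated + sum f cubic + sum f mixed + sum f saturated"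
proof -
  have b: "big = isolated \<union> cubic \<union> mixed \<union> saturated"
    by (auto simp: isolated_def cubic_def saturated_def mixed_def)
  \<comment> \<open>All four neighbours of a saturated vertex are big, so it has a big
    neighbour.\<close>
  have ns: "saturated \<inter> isolated = {}"
    by (auto simp: isolated_def saturated_def Int_absorb2)
  have d: "isolated \<inter> cubic = {}" "(isolated \<union> cubic) \<inter> mixed = {}" "(isolated \<union> cubic \<union> mixed) \<inter> saturated = {}"
    using ns by (auto simp: cubic_def mixed_def saturated_def)
  show ?thesis unfolding b
    using fin d by (simp add: sum.union_disjoint)
qed

lemma V_split: "V = big \<union> small" "big \<inter> small = {}"
  by (auto simp: big_def small_def)

lemma sum_V: "sum f V = sum f big + sum f small" for f :: "'a \<Rightarrow> nat"
  by (subst V_split(1), rule sum.union_disjoint) (use fin V_split(2) in auto)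

lemma small_deg: "v \<in> small \<Longrightarrow> deg v \<le> 2"
  by (auto simp: small_def big_def)

lemma card_V: "card V = card isolated + card cubic + card mixed + card saturated + card small"
  using big_sum[of "\<lambda>_. 1"] sum_V[of "\<lambda>_. 1"] by simp

lemma sum_le_mult: "(\<And>v. v \<in> A \<Longrightarrow> f v \<le> k) \<Longrightarrow> sum f A \<le> k * card A" for f :: "'a \<Rightarrow> nat"
  using sum_bounded_above[of A f k] by (simp add: mult.commute)

text \<open>This splits every edge evenly between its ends. Degrees of isolated vertices are not
  bounded here and so remain as a sum.\<close>

lemma edges_by_degree:
  "2 * card E \<le> (\<Sum>v\<in>isolated. deg v) + 3 * card cubic + 4 * card mixed + 4 * card saturated + 2 * card small"
proof -
  have "sum deg cubic \<le> 3 * card cubic" by (rule sum_le_mult) (auto simp: cubic_def)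
  moreover have "sum deg mixed \<le> 4 * card mixed"
    by (rule sum_le_mult) (use nonisolated_deg in \<open>fastforce simp: mixed_def\<close>)
  moreover have "sum deg saturated \<le> 4 * card saturated" by (rule sum_le_mult) (auto simp: saturated_def)
  moreover have "sum deg small \<le> 2 * card small" by (rule sum_le_mult) (use small_deg in auto)
  moreover have "2 * card E = sum deg big + sum deg small"
    using card_edges sum_V[of deg] by simp
  ultimately show ?thesis using big_sum[of deg] by linarith
qed

text \<open>Each edge between big and small is moved to its small end by
  \<open>sum_card_N_swap\<close>. A small vertex then carries at most 2 + 2, an isolated one
  nothing, and a mixed one at most 3, because it has degree 4 and some small neighbour.\<close>

lemma edges_charged_to_small:
  "2 * card E \<le> 3 * card cubic + 3 * card mixed + 4 * card saturated + 4 * card small"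
proof -
  have split: "deg v = card (N v \<inter> big) + card (N v \<inter> small)" for v
  proof -
    have "N v = (N v \<inter> big) \<union> (N v \<inter> small)" using N_sub V_split by blast
    then show ?thesis using V_split(2) by (metis card_Un_disjoint finite_Int finite_N inf_assoc inf_bot_right inf_left_commute)
  qed
  have "2 * card E = sum deg big + sum deg small"
    using card_edges sum_V[of deg] by simp
  also have "sum deg big = (\<Sum>v\<in>big. card (N v \<inter> big)) + (\<Sum>v\<in>small. card (N v \<inter> big))"
    unfolding split sum.distrib using sum_card_N_swap[of small big] fin by simp
  also have "(\<Sum>v\<in>small. card (N v \<inter> big)) \<le> 2 * card small"
  proof (rule sum_le_mult)
    show "card (N v \<inter> big) \<le> 2" if "v \<in> small" for v
      using small_deg[OF that] split[of v] by linarith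
  qed
  also have "sum deg small \<le> 2 * card small" by (rule sum_le_mult) (use small_deg in auto)
  finally have "2 * card E \<le> (\<Sum>v\<in>big. card (N v \<inter> big)) + 4 * card small" by simp
  moreover have "(\<Sum>v\<in>isolated. card (N v \<inter> big)) = 0" by (auto simp: isolated_def)
  moreover have "(\<Sum>v\<in>cubic. card (N v \<inter> big)) \<le> 3 * card cubic"
    by (rule sum_le_mult) (use split in \<open>auto simp: cubic_def\<close>)
  moreover have "(\<Sum>v\<in>saturated. card (N v \<inter> big)) \<le> 4 * card saturated"
    by (rule sum_le_mult) (use split in \<open>auto simp: saturated_def\<close>)
  moreover have "(\<Sum>v\<in>mixed. card (N v \<inter> big)) \<le> 3 * card mixed"
  proof (rule sum_le_mult)
    fix v assume v: "v \<in> mixed"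
    then have "deg v = 4" using nonisolated_deg[of v] by (auto simp: mixed_def cubic_def)
    moreover from this have "\<not> N v \<subseteq> big" using v by (auto simp: mixed_def saturated_def)
    then have "N v \<inter> small \<noteq> {}" using N_sub V_split by blast
    then have "card (N v \<inter> small) > 0" by (simp add: card_gt_0_iff)
    ultimately show "card (N v \<inter> big) \<le> 3" using split[of v] by linarith
  qed
  ultimately show ?thesis using big_sum[of "\<lambda>v. card (N v \<inter> big)"] by linarith
qed

lemma edge_bound:
  assumes "card V \<ge> 16"
  shows "card E \<le> 2 * card V - 4"
proof -
  consider "isolated = {}" | s where "isolated = {s}" | "card isolated \<ge> 2"
    using fin by (metis One_nat_def Suc_1 card_1_singletonE card_eq_0_iff less_2_cases not_less)
  then show ?thesis
  proof cases
    \<comment> \<open>Let D be \<open>4 * card V - 2 * card E\<close>. The two estimates give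
      \<open>D \<ge> card cubic + 2 * card small\<close> and
      \<open>D \<ge> card cubic + card mixed\<close>. With
      \<open>2 * card saturated \<le> 3 * card cubic\<close> they yield
      \<open>2 * card V \<le> 5 * D\<close>. So 16 vertices force \<open>D \<ge> 7\<close>, and D is
      even, hence at least 8.\<close>
    case 1
    then show ?thesis
      using edges_by_degree edges_charged_to_small card_V saturated_le_cubic assms by simp
  next
    case 2
    then have "N s \<inter> big = {}" by (auto simp: isolated_def)
    then have "N s \<subseteq> small" using N_sub V_split(1) by blast
    \<comment> \<open>This bounds the one unbounded degree. With D as before, \<open>D - 4\<close>
      is at least \<open>card cubic + card small\<close> and at least
      \<open>card cubic + card mixed\<close>, so
      \<open>2 * (card V - 1) \<le> 5 * (D - 4)\<close>.\<close>
    then have "deg s \<le> card small" using fin by (intro card_mono)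
    then show ?thesis
      using edges_by_degree edges_charged_to_small card_V saturated_le_cubic assms 2 by simp
  next
    \<comment> \<open>Isolated vertices carry no charge and all others at most 4, so two isolated
      ones save 8 out of \<open>4 * card V\<close>.\<close>
    case 3
    then show ?thesis
      using edges_charged_to_small card_V by linarith
  qed
qed

end

lemma planar_S22_free_edge_bound:
  assumes "planar_graph V E" "\<not> contains_subgraph V E (fst (double_star 2 2)) (snd (double_star 2 2))"
    "card V \<ge> 16"
  shows "card E \<le> 2 * card V - 4"
proof -
  interpret S22_free_graph V E
  proof
    show "simple_graph V E" using assms(1) by (simp add: planar_graph_def)
  qed (fact assms(2), rule planar_graph_no_K5[OF assms(1)])
  show ?thesis using edge_bound assms(3) .
qed

section \<open>The lower bound\<close>

text \<open>Here \<open>n\<close> counts all vertices: the parts are \<open>{0,1}\<close> and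
  \<open>{2..<n}\<close>.\<close>

definition K_2_m_edges :: "nat \<Rightarrow> nat set set" where
  "K_2_m_edges n = {{i,j} | i j. i < 2 \<and> 2 \<le> j \<and> j < n}"

lemma card_K_2_m_edges: "card (K_2_m_edges n) = 2 * (n - 2)"
proof -
  have "K_2_m_edges n = (\<lambda>(i,j). {i,j}) ` ({..<2} \<times> {2..<n})"
    by (force simp: K_2_m_edges_def)
  moreover have "inj_on (\<lambda>(i,j). {i,j}) ({..<2} \<times> {2..<n})"
    by (auto simp: inj_on_def doubleton_eq_iff)
  ultimately show ?thesis by (simp add: card_image)
qed

text \<open>One end of the backbone would lie in the larger part, where vertices have only the
  neighbours 0 and 1, yet it needs three.\<close>

lemma K_2_m_edges_S22_free:
  "\<not> contains_subgraph V (K_2_m_edges n) (fst (double_star 2 2)) (snd (double_star 2 2))"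
proof
  assume "contains_subgraph V (K_2_m_edges n) (fst (double_star 2 2)) (snd (double_star 2 2))"
  then obtain \<phi> where inj: "inj_on \<phi> {0..5::nat}"
    and edges: "\<And>e. e \<in> snd (double_star 2 2) \<Longrightarrow> \<phi> ` e \<in> K_2_m_edges n"
  proof -
    assume *: "\<And>\<phi>. inj_on \<phi> {0..5} \<Longrightarrow> (\<And>e. e \<in> snd (double_star 2 2) \<Longrightarrow> \<phi> ` e \<in> K_2_m_edges n) \<Longrightarrow> thesis"
    assume "contains_subgraph V (K_2_m_edges n) (fst (double_star 2 2)) (snd (double_star 2 2))"
    then obtain \<phi> where "inj_on \<phi> (fst (double_star 2 2))" "\<forall>e\<in>snd (double_star 2 2). \<phi> ` e \<in> K_2_m_edges n"
      unfolding contains_subgraph_def by (elim exE conjE) (rule that)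
    moreover have "fst (double_star 2 2) = {0..5}" by (simp add: double_star_def)
    ultimately show thesis by (intro *[of \<phi>]) simp_all
  qed
  have star: "{0,1} \<in> snd (double_star 2 2)" "{0,2} \<in> snd (double_star 2 2)" "{0,3} \<in> snd (double_star 2 2)"
    "{1,4} \<in> snd (double_star 2 2)" "{1,5} \<in> snd (double_star 2 2)"
    by (auto simp: double_star_def)
  have e: "\<phi> 0 < 2 \<longleftrightarrow> \<not> \<phi> 1 < 2" "\<phi> 0 < 2 \<longleftrightarrow> \<not> \<phi> 2 < 2" "\<phi> 0 < 2 \<longleftrightarrow> \<not> \<phi> 3 < 2"
    "\<phi> 1 < 2 \<longleftrightarrow> \<not> \<phi> 4 < 2" "\<phi> 1 < 2 \<longleftrightarrow> \<not> \<phi> 5 < 2"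
    using star[THEN edges] by (auto simp: K_2_m_edges_def doubleton_eq_iff)
  have ne: "\<phi> 0 \<noteq> \<phi> 4" "\<phi> 0 \<noteq> \<phi> 5" "\<phi> 4 \<noteq> \<phi> 5" "\<phi> 1 \<noteq> \<phi> 2" "\<phi> 1 \<noteq> \<phi> 3" "\<phi> 2 \<noteq> \<phi> 3"
    using inj by (simp_all add: inj_on_eq_iff[OF inj])
  show False using e ne by presburger
qed

text \<open>Vertices 0 and 1 are the apexes (0,1) and (0,-1), the others sit at (k,0), and edges are
  segments. Segments from one apex meet only there; those from opposite apexes lie in opposite
  half-planes and meet only on the axis.\<close>

lemma planar_K_2_m_edges: "planar_graph {..<n} (K_2_m_edges n)"
proof -
  define s :: "nat \<Rightarrow> real" where "s i = (if i = 0 then 1 else -1)" for i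
  define f :: "nat \<Rightarrow> real^2" where
    "f k = (if k < 2 then vector [0, s k] else vector [real k, 0])" for k
  \<comment> \<open>Edges are unordered; the smaller end is always the apex.\<close>
  define \<gamma> :: "nat set \<Rightarrow> real \<Rightarrow> real^2" where "\<gamma> e = linepath (f (Min e)) (f (Max e))" for e
  have \<gamma>: "\<gamma> {i,j} = linepath (f i) (f j)" if "i < 2" "2 \<le> j" for i j
    using that by (simp add: \<gamma>_def)
  have s: "s i \<noteq> 0" "s i = s k \<longleftrightarrow> i = k" if "i < 2" "k < 2" for i k
    using that by (auto simp: s_def)
  have inj: "inj f"
    by (rule injI) (auto simp: f_def vec_eq_iff forall_2 vector_2 s_def less_2_cases_iff split: if_splits)
  have pt: "p \<in> path_image (linepath (f i) (f j)) \<longleftrightarrow>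
      (\<exists>t. 0 \<le> t \<and> t \<le> 1 \<and> p $ 1 = t * real j \<and> p $ 2 = (1 - t) * s i)" if "i < 2" "2 \<le> j" for i j p
  proof -
    have "linepath (f i) (f j) t $ 1 = t * real j \<and> linepath (f i) (f j) t $ 2 = (1 - t) * s i" for t
      using that by (simp add: linepath_def f_def vector_2)
    then show ?thesis by (simp add: path_image_def image_iff vec_eq_iff forall_2 Bex_def conj_assoc)
  qed
  have on_vertex: "k = i \<or> k = j" if "i < 2" "2 \<le> j" "f k \<in> path_image (linepath (f i) (f j))" for i j k
  proof -
    note on = that(3)
    obtain t where t: "0 \<le> t" "t \<le> 1" "f k $ 1 = t * real j" "f k $ 2 = (1 - t) * s i"
      using pt[OF \<open>i < 2\<close> \<open>2 \<le> j\<close>, of "f k"] on by blast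
    show ?thesis
    proof (cases "k < 2")
      case True
      then have "t = 0" using t(3) that(2) by (simp add: f_def vector_2)
      then show ?thesis using t(4) True s[of k i] that by (simp add: f_def vector_2)
    next
      case False
      then have "t = 1" using t(4) s[of i i] that by (simp add: f_def vector_2)
      then show ?thesis using t(3) False by (simp add: f_def vector_2)
    qed
  qed
  have meet: "p \<in> f ` ({i,j} \<inter> {k,l})"
    if "i < 2" "2 \<le> j" "k < 2" "2 \<le> l" "{i,j} \<noteq> {k,l}"
      "p \<in> path_image (linepath (f i) (f j))" "p \<in> path_image (linepath (f k) (f l))" for i j k l p
  proof -
    note on = pt[OF that(1,2), THEN iffD1, OF that(6)] pt[OF that(3,4), THEN iffD1, OF that(7)]
    obtain t u where t: "0 \<le> t" "t \<le> 1" "p $ 1 = t * real j" "p $ 2 = (1 - t) * s i"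
      and u: "0 \<le> u" "u \<le> 1" "p $ 1 = u * real l" "p $ 2 = (1 - u) * s k"
      using on by blast
    show ?thesis
    proof (cases "i = k")
      case True
      \<comment> \<open>Equal heights give equal parameters, and then \<open>t * j = t * l\<close>
        with \<open>j \<noteq> l\<close> leaves only the apex.\<close>
      then have tu: "t = u" using t(4) u(4) s[of i i] that by simp
      moreover have "j \<noteq> l" using True that by auto
      ultimately have "t = 0" using t(3) u(3) by simp
      then have "p = f i" using t that by (simp add: f_def vec_eq_iff forall_2 vector_2)
      then show ?thesis using True by simp
    next
      case False
      then have "s k = - s i" using that by (auto simp: s_def less_2_cases_iff)
      \<comment> \<open>Heights of opposite signs agree only at 0, so both parameters are 1.\<close>
      then have "((1 - t) + (1 - u)) * s i = 0" using t(4) u(4) by (simp add: algebra_simps)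
      then have "(1 - t) + (1 - u) = 0" using s(1)[OF that(1,1)] by simp
      then have "t = 1" "u = 1" using t u by linarith+
      then have "j = l" "p = f j" using t u that by (simp_all add: f_def vec_eq_iff forall_2 vector_2)
      then show ?thesis by simp
    qed
  qed
  have arc: "arc (\<gamma> e) \<and> {pathstart (\<gamma> e), pathfinish (\<gamma> e)} = f ` e \<and> path_image (\<gamma> e) \<inter> f ` {..<n} = f ` e"
    if e: "e \<in> K_2_m_edges n" for e
  proof -
    obtain i j where ij: "e = {i,j}" "i < 2" "2 \<le> j" "j < n" using e by (auto simp: K_2_m_edges_def)
    have "f i \<noteq> f j" using inj ij by (auto dest: injD)
    moreover have "path_image (linepath (f i) (f j)) \<inter> f ` {..<n} \<subseteq> {f i, f j}"
      using on_vertex[OF ij(2,3)] by blast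
    moreover have "{f i, f j} \<subseteq> path_image (linepath (f i) (f j)) \<inter> f ` {..<n}"
      using ij by auto
    ultimately show ?thesis using \<gamma>[OF ij(2,3)] ij(1) by auto
  qed
  have cross: "path_image (\<gamma> e) \<inter> path_image (\<gamma> e') \<subseteq> f ` (e \<inter> e')"
    if e: "e \<in> K_2_m_edges n" "e' \<in> K_2_m_edges n" "e \<noteq> e'" for e e'
  proof -
    obtain i j where ij: "e = {i,j}" "i < 2" "2 \<le> j" using e by (auto simp: K_2_m_edges_def)
    obtain k l where kl: "e' = {k,l}" "k < 2" "2 \<le> l" using e by (auto simp: K_2_m_edges_def)
    show ?thesis
      using meet[OF ij(2,3) kl(2,3)] e(3) \<gamma> ij kl by auto
  qed
  have "simple_graph {..<n} (K_2_m_edges n)"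
    unfolding simple_graph_def
  proof (intro conjI ballI)
    fix e assume "e \<in> K_2_m_edges n"
    then obtain i j where "e = {i,j}" "i < 2" "2 \<le> j" "j < n" by (auto simp: K_2_m_edges_def)
    then show "\<exists>u v. u \<in> {..<n} \<and> v \<in> {..<n} \<and> u \<noteq> v \<and> e = {u,v}"
      by (intro exI[of _ i] exI[of _ j]) auto
  qed simp
  then show ?thesis
    unfolding planar_graph_def using inj_on_subset[OF inj subset_UNIV] arc cross
    by (intro conjI exI[of _ f] exI[of _ \<gamma>] ballI impI) simp_all
qed

theorem theorem1p1:
  fixes n :: nat
  assumes "n \<ge> 16"
  shows "planar_turan n (double_star 2 2) = 2 * n - 4"
proof -
  let ?S = "{card E | E. \<exists>V :: nat set. card V = n \<and> planar_graph V E \<and>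
      \<not> contains_subgraph V E (fst (double_star 2 2)) (snd (double_star 2 2))}"
  have bound: "x \<le> 2 * n - 4" if "x \<in> ?S" for x
    using that planar_S22_free_edge_bound assms by blast
  have "Max ?S = 2 * n - 4"
  proof (rule Max_eqI[OF _ bound])
    \<comment> \<open>Finiteness of the set of edge counts follows from the upper bound
      itself.\<close>
    show "finite ?S" by (rule finite_subset[of _ "{..2 * n - 4}"]) (use bound in auto)
    have "2 * n - 4 = card (K_2_m_edges n)" by (simp add: card_K_2_m_edges)
    moreover have "card {..<n} = n" by simp
    ultimately show "2 * n - 4 \<in> ?S" using planar_K_2_m_edges K_2_m_edges_S22_free by blast
  qed
  then show ?thesis unfolding planar_turan_def .
qed

end
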